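(* Let $q$ be a prime power. Then $$\lim_{x\to\infty}\ \sum_{\substack{A\in\mathbb{F}_q[T]\text{ monic}\\ 1\le\deg A\le x}}\frac{\mu(A)\,\Omega(A)}{q^{\deg A}}=0.$$
   Context: A prime in $\mathbb{F}_q[T]$ is a monic irreducible polynomial. For monic $A$, $\mu(A)=1$ if $A=1$, $\mu(A)=(-1)^k$ if $A$ is a product of $k$ distinct primes, and $\mu(A)=0$ otherwise. $\Omega(A)=\#\{\deg P: P\text{ prime}, P\mid A\}$ is the number of distinct degrees of prime divisors of $A$ (not the number of prime factors). *)

theory Defs
  imports Complex_Main "HOL-Library.Cardinality" "HOL-Computational_Algebra.Polynomial_Factorial"
begin

definition poly_monic :: "'a::field poly \<Rightarrow> bool" where
  "poly_monic A \<longleftrightarrow> lead_coeff A = 1"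

definition poly_prime :: "'a::field poly \<Rightarrow> bool" where
  "poly_prime P \<longleftrightarrow> poly_monic P \<and> irreducible P"

definition distinct_prime_product :: "nat \<Rightarrow> 'a::field poly \<Rightarrow> bool" where
  "distinct_prime_product k A \<longleftrightarrow>
     (\<exists>S. finite S \<and> card S = k \<and> (\<forall>P\<in>S. poly_prime P) \<and> A = \<Prod>S)"

text \<open>Only used for monic arguments. The number \<open>k\<close> of factors is unique by unique factorization,
  see \<open>distinct_prime_product_unique\<close> below.\<close>

definition poly_mu :: "'a::field poly \<Rightarrow> int" where
  "poly_mu A =
     (if A = 1 then 1
      else if \<exists>k. distinct_prime_product k A then (-1) ^ (THE k. distinct_prime_product k A)
      else 0)"

text \<open>The number of distinct degrees of the prime divisors, not the number of prime factors.
  For \<open>A \<noteq> 0\<close> the set of degrees is finite, see \<open>finite_prime_divisor_degrees\<close>.\<close>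

definition poly_Omega :: "'a::field poly \<Rightarrow> nat" where
  "poly_Omega A = card {degree P | P. poly_prime P \<and> P dvd A}"

lemma poly_prime_dvd_imp_eq:
  assumes "poly_prime P" "poly_prime Q" "P dvd Q"
  shows "P = Q"
proof -
  from assms(3) obtain R where R: "Q = P * R" by (elim dvdE)
  have "\<not> is_unit P" using assms(1) by (simp add: poly_prime_def irreducible_def)
  with assms(2) R have "is_unit R" unfolding poly_prime_def by (metis irreducibleD)
  then obtain c where c: "R = [:c:]" by (auto simp: is_unit_poly_iff)
  have "lead_coeff Q = lead_coeff P * lead_coeff R" by (simp add: R lead_coeff_mult)
  with assms c have "c = 1" by (simp add: poly_prime_def poly_monic_def)
  with R c show ?thesis by simp
qed

lemma prime_divisors_distinct_prime_product:
  fixes S :: "'a::field poly set"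
  assumes "finite S" "\<forall>P\<in>S. poly_prime P"
  shows "{P. poly_prime P \<and> P dvd \<Prod>S} = S"
proof (intro equalityI subsetI)
  fix P assume "P \<in> {P. poly_prime P \<and> P dvd \<Prod>S}"
  then have P: "poly_prime P" "P dvd \<Prod>S" by auto
  then have "prime_elem P" by (simp add: poly_prime_def field_poly_irreducible_imp_prime)
  with assms(1) P(2) have "\<exists>Q\<in>S. P dvd Q"
    by (induction S rule: finite_induct) (auto simp: prime_elem_dvd_mult_iff)
  with poly_prime_dvd_imp_eq P(1) assms(2) show "P \<in> S" by blast
next
  fix P assume "P \<in> S"
  with assms show "P \<in> {P. poly_prime P \<and> P dvd \<Prod>S}"
    by (auto simp: dvd_prod_eqI)
qed

lemma distinct_prime_product_unique:
  "distinct_prime_product k A \<Longrightarrow> k = card {P. poly_prime P \<and> P dvd A}"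
  by (auto simp: distinct_prime_product_def prime_divisors_distinct_prime_product)

lemma poly_mu_distinct_prime_product:
  assumes "distinct_prime_product k A"
  shows "poly_mu A = (-1) ^ k"
proof -
  have "(THE k. distinct_prime_product k A) = k"
  proof (rule the_equality)
    fix j assume "distinct_prime_product j A"
    from distinct_prime_product_unique[OF this] distinct_prime_product_unique[OF assms]
    show "j = k" by (rule trans[OF _ sym])
  qed (fact assms)
  moreover have "k = 0" if "A = 1"
  proof -
    have "distinct_prime_product 0 A"
      unfolding distinct_prime_product_def by (rule exI[of _ "{}"]) (simp add: that)
    from distinct_prime_product_unique[OF assms] distinct_prime_product_unique[OF this]
    show ?thesis by (rule trans[OF _ sym])
  qed
  moreover have "\<exists>k. distinct_prime_product k A" using assms by (rule exI)
  ultimately show ?thesis by (simp add: poly_mu_def)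
qed

lemma finite_prime_divisor_degrees:
  assumes "A \<noteq> (0 :: 'a::field poly)"
  shows "finite {degree P | P. poly_prime P \<and> P dvd A}"
proof (rule finite_subset)
  show "{degree P | P. poly_prime P \<and> P dvd A} \<subseteq> {..degree A}"
    using assms by (blast intro: atMost_iff[THEN iffD2] dvd_imp_degree_le)
qed simp

lemma finite_poly_degree_le:
  "finite {A :: 'a::{field,finite} poly. degree A \<le> n}"
proof -
  have "finite {xs :: 'a list. set xs \<subseteq> UNIV \<and> length xs \<le> Suc n}"
    by (rule finite_lists_length_le) (rule finite)
  then have "finite (Poly ` {xs :: 'a list. set xs \<subseteq> UNIV \<and> length xs \<le> Suc n})"
    by (rule finite_imageI)
  moreover have "{A :: 'a poly. degree A \<le> n} \<subseteq> Poly ` {xs. set xs \<subseteq> UNIV \<and> length xs \<le> Suc n}"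
  proof
    fix A :: "'a poly" assume "A \<in> {A. degree A \<le> n}"
    then have "length (coeffs A) \<le> Suc n" by (cases "A = 0") (simp_all add: length_coeffs)
    then have "coeffs A \<in> {xs. set xs \<subseteq> UNIV \<and> length xs \<le> Suc n}" by simp
    with Poly_coeffs[symmetric] show "A \<in> Poly ` {xs. set xs \<subseteq> UNIV \<and> length xs \<le> Suc n}"
      by (rule image_eqI)
  qed
  ultimately show ?thesis by (rule finite_subset[rotated])
qed

text \<open>The range of summation in the theorem is finite, so the sum there is a genuine one.\<close>

lemma finite_monic_degree_le:
  "finite {A :: 'a::{field,finite} poly. poly_monic A \<and> 1 \<le> degree A \<and> real (degree A) \<le> x}"
  by (rule finite_subset[OF _ finite_poly_degree_le[of "nat \<lfloor>x\<rfloor>"]]) (auto simp: le_nat_floor)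

end

(*
  The monic multiples of A of degree N number q^(N - deg A). So q^N times the sum over
  1 <= deg A <= N is the sum, over monic C of degree N, of mu(A) Omega(A) over the monic divisors
  A of C. By inclusion-exclusion over the set of prime divisors of C the inner sum is -1 if these
  primes all have the same degree and 0 otherwise. Such C are the products of m primes of degree d
  with d m = N. There are at most q^d/d primes of degree d, and counting multisets of them bounds
  the number of such C by q^N (m + 1) / (2 d)^m. Summing over m shows that the partial sum is at
  most 8/N in absolute value.
*)
theory Submission
  imports Defs "HOL-Library.FuncSet"
begin

section \<open>Monic polynomials: counts by degree and counts of multiples\<close>

lemma monic_nonzero: "poly_monic A \<Longrightarrow> A \<noteq> 0"
  by (auto simp: poly_monic_def)

lemma poly_prime_degree_pos: "poly_prime P \<Longrightarrow> 0 < degree P"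
  by (auto simp: poly_prime_def poly_monic_def irreducible_def is_unit_iff_degree)

lemma poly_monic_prod: "(\<And>x. x \<in> S \<Longrightarrow> poly_monic (f x)) \<Longrightarrow> poly_monic (\<Prod>x\<in>S. f x)"
  by (simp add: poly_monic_def lead_coeff_prod)

lemma poly_monic_degree_0_iff: "poly_monic A \<and> degree A = 0 \<longleftrightarrow> A = 1"
  by (auto simp: poly_monic_def elim!: degree_eq_zeroE)

lemma finite_monic_degree:
  "finite {A :: 'a::{field,finite} poly. poly_monic A \<and> degree A = n}"
  by (rule finite_subset[OF _ finite_poly_degree_le[of n]]) auto

text \<open>Splitting off the constant coefficient with \<open>pCons\<close> lowers the degree by
  one, and that coefficient is arbitrary.\<close>

lemma card_monic_degree:
  "card {A :: 'a::{field,finite} poly. poly_monic A \<and> degree A = n} = CARD('a) ^ n"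
proof (induction n)
  case 0
  show ?case by (simp add: poly_monic_degree_0_iff)
next
  case (Suc n)
  have "{A :: 'a poly. poly_monic A \<and> degree A = Suc n} =
      (\<lambda>(c, A). pCons c A) ` (UNIV \<times> {A. poly_monic A \<and> degree A = n})"
  proof (intro equalityI subsetI)
    fix A :: "'a poly" assume A: "A \<in> {A. poly_monic A \<and> degree A = Suc n}"
    obtain c B where "A = pCons c B" by (rule pCons_cases)
    with A show "A \<in> (\<lambda>(c, A). pCons c A) ` (UNIV \<times> {A. poly_monic A \<and> degree A = n})"
      by (auto simp: poly_monic_def degree_pCons_eq_if split: if_splits)
  qed (auto simp: poly_monic_def degree_pCons_eq_if)
  moreover have "inj_on (\<lambda>(c, A). pCons c A) (UNIV \<times> {A :: 'a poly. poly_monic A \<and> degree A = n})"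
    by (auto simp: inj_on_def)
  ultimately show ?case
    by (simp add: card_image card_cartesian_product Suc)
qed

text \<open>Adding the leading term \<open>monom 1 n\<close> reduces this to the monic count. For
  \<open>n = 0\<close> it would fail: as \<open>degree 0 = 0\<close>, the set is then empty.\<close>

lemma card_degree_less:
  assumes "0 < n"
  shows "card {A :: 'a::{field,finite} poly. degree A < n} = CARD('a) ^ n"
proof -
  have "bij_betw (\<lambda>A. A + monom 1 n) {A :: 'a poly. degree A < n}
      {A. poly_monic A \<and> degree A = n}"
  proof (rule bij_betwI[where g = "\<lambda>A. A - monom 1 n"])
    show "(\<lambda>A. A + monom 1 n) \<in> {A :: 'a poly. degree A < n} \<rightarrow> {A. poly_monic A \<and> degree A = n}"
      by (auto simp: poly_monic_def degree_add_eq_right degree_monom_eq coeff_eq_0)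
    show "(\<lambda>A. A - monom 1 n) \<in> {A :: 'a poly. poly_monic A \<and> degree A = n} \<rightarrow> {A. degree A < n}"
    proof
      fix A :: "'a poly" assume "A \<in> {A. poly_monic A \<and> degree A = n}"
      then have "degree (A - monom 1 n) \<le> n" "coeff (A - monom 1 n) n = 0"
        by (auto simp: poly_monic_def intro!: degree_diff_le degree_monom_le)
      with assms show "A - monom 1 n \<in> {A. degree A < n}"
        using eq_zero_or_degree_less by force
    qed
  qed auto
  then show ?thesis
    by (simp add: bij_betw_same_card card_monic_degree)
qed

text \<open>The cofactors are exactly the monic polynomials of the complementary degree. The bound
  on \<open>degree A\<close> keeps the natural subtraction from truncating.\<close>

lemma card_monic_multiples:
  fixes A :: "'a::{field,finite} poly"
  assumes "poly_monic A" "degree A \<le> n"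
  shows "card {C. poly_monic C \<and> degree C = n \<and> A dvd C} = CARD('a) ^ (n - degree A)"
proof -
  have "A \<noteq> 0" using assms(1) by (rule monic_nonzero)
  have "{C. poly_monic C \<and> degree C = n \<and> A dvd C} =
      (*) A ` {B. poly_monic B \<and> degree B = n - degree A}"
  proof (intro equalityI subsetI)
    fix C assume "C \<in> {C. poly_monic C \<and> degree C = n \<and> A dvd C}"
    then obtain B where B: "C = A * B" "poly_monic (A * B)" "degree (A * B) = n" by (auto elim: dvdE)
    have "B \<noteq> 0" using monic_nonzero[OF B(2)] by auto
    moreover have "poly_monic B"
      using assms(1) B(2) unfolding poly_monic_def by (simp only: lead_coeff_mult mult_1_left)
    ultimately show "C \<in> (*) A ` {B. poly_monic B \<and> degree B = n - degree A}"
      using B(1,3) \<open>A \<noteq> 0\<close> by (auto simp: degree_mult_eq)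
  next
    fix C assume "C \<in> (*) A ` {B. poly_monic B \<and> degree B = n - degree A}"
    then obtain B where B: "C = A * B" "poly_monic B" "degree B = n - degree A" by auto
    from assms(1) B(2) have "poly_monic (A * B)"
      unfolding poly_monic_def by (simp only: lead_coeff_mult mult_1_left)
    with assms(2) B \<open>A \<noteq> 0\<close> monic_nonzero[OF B(2)]
    show "C \<in> {C. poly_monic C \<and> degree C = n \<and> A dvd C}"
      by (auto simp: degree_mult_eq)
  qed
  moreover have "inj_on ((*) A) {B. poly_monic B \<and> degree B = n - degree A}"
    using \<open>A \<noteq> 0\<close> by (auto simp: inj_on_def)
  ultimately show ?thesis
    by (simp add: card_image card_monic_degree)
qed

section \<open>Primes: Fermat's little theorem and a bound for the number of primes of given
  degree\<close>

text \<open>A further prime \<open>P\<close> does not divide the product of the others, whose only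
  prime divisors are its factors, so \<open>P\<close> must divide the cofactor.\<close>

lemma prod_poly_primes_dvd:
  assumes "finite S" "\<And>P. P \<in> S \<Longrightarrow> poly_prime P" "\<And>P. P \<in> S \<Longrightarrow> P dvd A"
  shows "\<Prod>S dvd A"
  using assms
proof (induction S)
  case (insert P S)
  then obtain B where B: "A = \<Prod>S * B" by (auto elim: dvdE)
  have "{Q. poly_prime Q \<and> Q dvd \<Prod>S} = S"
    using insert by (intro prime_divisors_distinct_prime_product) auto
  with insert have "\<not> P dvd \<Prod>S" by auto
  moreover have "prime_elem P"
    using insert by (simp add: poly_prime_def field_poly_irreducible_imp_prime)
  moreover have "P dvd \<Prod>S * B" using insert.prems(2)[of P] B by simp
  ultimately have "P dvd B" by (simp add: prime_elem_dvd_mult_iff)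
  with insert B show ?case by (simp add: mult.commute mult_dvd_mono)
qed simp

text \<open>Fermat's little theorem in the residue field modulo \<open>P\<close>: multiplication by \<open>F\<close> permutes
  the nonzero residues.\<close>

lemma poly_prime_dvd_power_card:
  fixes P F :: "'a::{field,finite} poly"
  assumes "poly_prime P"
  shows "P dvd F ^ (CARD('a) ^ degree P) - F"
proof (cases "P dvd F")
  case True
  then have "P dvd F ^ (CARD('a) ^ degree P)" by (rule dvd_trans) (rule dvd_power, simp)
  then show ?thesis using True by (rule dvd_diff)
next
  case False
  \<comment> \<open>Representatives of the nonzero residue classes modulo \<open>P\<close>; there
    are \<open>?n - 1\<close> of them.\<close>
  let ?R = "{r. degree r < degree P} - {0 :: 'a poly}"
  let ?n = "CARD('a) ^ degree P"
  have pos: "0 < degree P" using assms by (rule poly_prime_degree_pos)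
  have P: "prime_elem P" "P \<noteq> 0"
    using assms pos by (auto simp: poly_prime_def field_poly_irreducible_imp_prime)
  have fin: "finite ?R"
    by (rule finite_subset[OF _ finite_poly_degree_le[of "degree P"]]) auto
  have ndvd: "\<not> P dvd r" if "r \<in> ?R" for r
    using that by (auto dest: dvd_imp_degree_le)
  have "inj_on (\<lambda>r. (F * r) mod P) ?R"
  proof (rule inj_onI)
    fix r s assume rs: "r \<in> ?R" "s \<in> ?R" "(F * r) mod P = (F * s) mod P"
    then have "P dvd F * r - F * s" by (simp only: mod_eq_dvd_iff)
    then have "P dvd F * (r - s)" by (simp only: right_diff_distrib)
    with P False have "P dvd r - s" by (simp add: prime_elem_dvd_mult_iff)
    then have "r mod P = s mod P" by (simp only: mod_eq_dvd_iff)
    with rs show "r = s" by (simp add: mod_poly_less)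
  qed
  moreover have "(\<lambda>r. (F * r) mod P) ` ?R \<subseteq> ?R"
  proof
    fix x assume "x \<in> (\<lambda>r. (F * r) mod P) ` ?R"
    then obtain r where r: "r \<in> ?R" "x = (F * r) mod P" by blast
    have "\<not> P dvd F * r"
      using P False ndvd[OF r(1)] by (simp add: prime_elem_dvd_mult_iff)
    then have "x \<noteq> 0" using r(2) by (simp add: dvd_eq_mod_eq_0)
    moreover have "degree x < degree P"
      using degree_mod_less[OF P(2), of "F * r"] \<open>x \<noteq> 0\<close> unfolding r(2) by blast
    ultimately show "x \<in> ?R" by simp
  qed
  ultimately have "bij_betw (\<lambda>r. (F * r) mod P) ?R ?R"
    unfolding bij_betw_def using endo_inj_surj[OF fin] by blast
  then have "\<Prod>?R = (\<Prod>r\<in>?R. (F * r) mod P)"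
    by (rule prod.reindex_bij_betw[symmetric])
  then have "\<Prod>?R mod P = (\<Prod>r\<in>?R. (F * r) mod P) mod P" by (rule arg_cong)
  also have "\<dots> = (\<Prod>r\<in>?R. F * r) mod P" by (rule mod_prod_eq)
  also have "(\<Prod>r\<in>?R. F * r) = F ^ card ?R * \<Prod>?R" by (simp only: prod.distrib prod_constant)
  also have "card ?R = ?n - 1"
    using pos fin by (simp add: card_degree_less card_Diff_singleton)
  finally have "\<Prod>?R mod P = (F ^ (?n - 1) * \<Prod>?R) mod P" .
  from this[symmetric] have "P dvd F ^ (?n - 1) * \<Prod>?R - \<Prod>?R"
    by (simp only: mod_eq_dvd_iff)
  then have "P dvd (F ^ (?n - 1) - 1) * \<Prod>?R"
    by (simp only: left_diff_distrib mult_1_left)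
  \<comment> \<open>So the product of the representatives can be cancelled modulo
    \<open>P\<close>.\<close>
  moreover have "\<not> P dvd \<Prod>?R"
  proof
    assume "P dvd \<Prod>?R"
    with fin P(1) obtain r where "r \<in> ?R" "P dvd r"
      using prime_elem_dvd_prod_msetE[of P "mset_set ?R"]
      by (auto simp: prod_unfold_prod_mset)
    with ndvd show False by blast
  qed
  ultimately have "P dvd F ^ (?n - 1) - 1"
    using P(1) by (simp only: prime_elem_dvd_mult_iff) simp
  then have "P dvd F * (F ^ (?n - 1) - 1)" by (rule dvd_mult)
  also have "F * (F ^ (?n - 1) - 1) = F * F ^ (?n - 1) - F"
    by (simp only: right_diff_distrib mult_1_right)
  also have "F * F ^ (?n - 1) = F ^ ?n" by (subst mult.commute) (rule power_minus_mult, simp)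
  finally show ?thesis .
qed

lemma CARD_field_ge_2: "2 \<le> CARD('a::{field,finite})"
proof -
  have "card {0, 1 :: 'a} \<le> CARD('a)" by (rule card_mono) auto
  then show ?thesis by simp
qed

text \<open>By Fermat applied to the variable T, every prime of degree \<open>d\<close> divides
  T^(q^d) - T, where q is the size of the field. Hence so does their product, and degrees are
  compared.\<close>

lemma card_primes_degree:
  fixes d :: nat
  shows "d * card {P :: 'a::{field,finite} poly. poly_prime P \<and> degree P = d} \<le> CARD('a) ^ d"
proof (cases "d = 0")
  case False
  let ?S = "{P :: 'a poly. poly_prime P \<and> degree P = d}"
  let ?F = "[:0, 1:] ^ (CARD('a) ^ d) - [:0, 1:] :: 'a poly"
  have fin: "finite ?S"
    by (rule finite_subset[OF _ finite_poly_degree_le[of d]]) auto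
  \<comment> \<open>The exponent exceeds 1, so subtracting T changes neither the degree nor the
    nonvanishing of the power.\<close>
  have "1 < CARD('a) ^ d"
    using CARD_field_ge_2[where 'a = 'a] False by (intro one_less_power) auto
  then have deg: "degree ?F = CARD('a) ^ d"
    by (simp add: diff_conv_add_uminus degree_add_eq_left degree_linear_power del: add_uminus_conv_diff)
  have "\<Prod>?S dvd ?F"
    using fin poly_prime_dvd_power_card[of _ "[:0, 1:] :: 'a poly"]
    by (intro prod_poly_primes_dvd) blast+
  moreover have "?F \<noteq> 0" using deg \<open>1 < CARD('a) ^ d\<close> by auto
  ultimately have "degree (\<Prod>?S) \<le> degree ?F"
    by (rule dvd_imp_degree_le)
  moreover have "degree (\<Prod>?S) = (\<Sum>P\<in>?S. degree P)"
    using False by (intro degree_prod_sum_eq) auto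
  ultimately show ?thesis unfolding deg by (simp add: mult.commute)
qed simp

section \<open>Two numerical estimates\<close>

text \<open>The binomial coefficient counts multisets of size \<open>m\<close> from \<open>n\<close>
  elements. Passing from \<open>m\<close> to \<open>m + 1\<close> multiplies it by (n + m) / (m +
  1), which is at most (m + 2) R / (m + 1).\<close>

lemma multiset_choose_le:
  fixes R :: real
  assumes "real n \<le> 2 * R" "1 \<le> R"
  shows "real ((n + m - 1) choose m) \<le> real (m + 1) * R ^ m"
proof (induction m)
  case (Suc m)
  have "Suc m * ((n + m) choose Suc m) = (n + m) * ((n + m - 1) choose m)"
    by (rule binomial_absorption)
  then have "real (Suc m) * real ((n + m) choose Suc m) = real (n + m) * real ((n + m - 1) choose m)"
    by (metis of_nat_mult)
  also have "\<dots> \<le> (real (m + 2) * R) * (real (m + 1) * R ^ m)"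
  proof (rule mult_mono)
    have "real m * 1 \<le> real m * R" using assms by (intro mult_left_mono) auto
    then show "real (n + m) \<le> real (m + 2) * R" using assms by (simp add: algebra_simps)
  qed (use Suc assms in auto)
  also have "\<dots> = real (Suc m) * (real (Suc m + 1) * R ^ Suc m)"
    by (simp add: algebra_simps)
  finally have "real ((n + m) choose Suc m) \<le> real (Suc m + 1) * R ^ Suc m"
    by (rule mult_left_le_imp_le) simp
  then show ?case by simp
qed simp

text \<open>The partial sums have a closed form, found by induction; 8 is the value of the infinite
  series.\<close>

lemma sum_m_Suc_m_power_half_le: "(\<Sum>m=1..N. real m * real (m + 1) / 2 ^ m) \<le> 8"
proof -
  have "(\<Sum>m=1..N. real m * real (m + 1) / 2 ^ m) = 8 - (real N ^ 2 + 5 * real N + 8) / 2 ^ N"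
    by (induction N) (simp_all add: field_simps power2_eq_square)
  then show ?thesis by simp
qed

section \<open>Inclusion-exclusion over the subsets of a finite set\<close>

text \<open>This is the expansion of a product over \<open>X\<close> whose factors are all
  \<open>1 - 1\<close>.\<close>

lemma sum_Pow_minus_one_power_card:
  assumes "finite X"
  shows "(\<Sum>S\<in>Pow X. (-1) ^ card S :: int) = (if X = {} then 1 else 0)"
  using prod_diff_conv_sum[OF assms, of "\<lambda>_. 1 :: int" "\<lambda>_. 1"] assms
  by (auto simp: power_0_left)

lemma sum_Pow_card_image:
  assumes "finite X" "X \<noteq> {}"
  shows "(\<Sum>S\<in>Pow X. (-1) ^ card S * int (card (f ` S))) = - (if card (f ` X) = 1 then 1 else 0)"
proof -
  have "int (card (f ` S)) = (\<Sum>d\<in>f ` X. if d \<in> f ` S then 1 else 0)" if "S \<in> Pow X" for S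
  proof -
    have "f ` X \<inter> f ` S = f ` S" using that by blast
    then show ?thesis using assms(1) by (simp add: sum.If_cases Int_def[symmetric])
  qed
  then have "(\<Sum>S\<in>Pow X. (-1) ^ card S * int (card (f ` S))) =
      (\<Sum>S\<in>Pow X. \<Sum>d\<in>f ` X. if d \<in> f ` S then (-1) ^ card S else 0)"
    by (simp add: sum_distrib_left if_distrib[of "(*) _"] cong: if_cong)
  also have "\<dots> = (\<Sum>d\<in>f ` X. \<Sum>S\<in>Pow X. if d \<in> f ` S then (-1) ^ card S else 0)"
    by (rule sum.swap)
  also have "\<dots> = (\<Sum>d\<in>f ` X. if f ` X = {d} then -1 else 0)"
  proof (rule sum.cong)
    fix d assume d: "d \<in> f ` X"
    \<comment> \<open>The subsets of \<open>?Y\<close> are those that miss the value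
      \<open>d\<close>. The sum over all subsets vanishes, so only their contribution remains, and
      it vanishes unless \<open>?Y\<close> is empty.\<close>
    let ?Y = "{x \<in> X. f x \<noteq> d}"
    have "(\<Sum>S\<in>Pow X. if d \<in> f ` S then (-1) ^ card S else (0::int)) =
        (\<Sum>S\<in>Pow X. (-1) ^ card S) - (\<Sum>S\<in>Pow X. if d \<in> f ` S then 0 else (-1) ^ card S)"
      by (simp flip: sum_subtractf cong: if_cong) (rule sum.cong, auto)
    also have "(\<Sum>S\<in>Pow X. if d \<in> f ` S then 0 else (-1) ^ card S :: int) = (\<Sum>S\<in>Pow ?Y. (-1) ^ card S)"
      using assms(1) by (intro sum.mono_neutral_cong_right) auto
    also have "(\<Sum>S\<in>Pow X. (-1) ^ card S :: int) - \<dots> = (if ?Y = {} then -1 else 0)"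
      using assms by (simp add: sum_Pow_minus_one_power_card)
    also have "?Y = {} \<longleftrightarrow> f ` X = {d}" using d by auto
    finally show "(\<Sum>S\<in>Pow X. if d \<in> f ` S then (-1) ^ card S else (0::int)) =
        (if f ` X = {d} then -1 else 0)" .
  qed simp
  also have "\<dots> = - (if card (f ` X) = 1 then 1 else 0)"
    using assms by (auto simp: card_1_singleton_iff)
  finally show ?thesis .
qed

section \<open>The sum over the monic divisors of a fixed polynomial\<close>

lemma finite_prime_divisors:
  fixes C :: "'a::{field,finite} poly"
  assumes "C \<noteq> 0"
  shows "finite {P. poly_prime P \<and> P dvd C}"
  using assms
  by (intro finite_subset[OF _ finite_poly_degree_le[of "degree C"]]) (auto dest: dvd_imp_degree_le)

text \<open>Only products of distinct primes contribute. They correspond to the sets of prime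
  divisors of \<open>C\<close>, which turns the sum into that of
  \<open>sum_Pow_card_image\<close>.\<close>

lemma sum_monic_divisors_mu_Omega:
  fixes C :: "'a::{field,finite} poly"
  assumes "poly_monic C" "{P. poly_prime P \<and> P dvd C} \<noteq> {}"
  shows "(\<Sum>A | poly_monic A \<and> A dvd C. poly_mu A * int (poly_Omega A)) =
    - (if card (degree ` {P. poly_prime P \<and> P dvd C}) = 1 then 1 else 0)"
proof -
  let ?X = "{P. poly_prime P \<and> P dvd C}"
  have C: "C \<noteq> 0" using assms(1) by (rule monic_nonzero)
  have X: "finite ?X" using C by (rule finite_prime_divisors)
  have fin: "finite {A. poly_monic A \<and> A dvd C}"
    using C by (intro finite_subset[OF _ finite_poly_degree_le[of "degree C"]]) (auto dest: dvd_imp_degree_le)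
  \<comment> \<open>A set of primes is recovered from its product; this gives injectivity below and
    later the value of \<open>poly_Omega\<close>.\<close>
  have div: "{P. poly_prime P \<and> P dvd \<Prod>S} = S" if "S \<in> Pow ?X" for S
    using that finite_subset[OF _ X] by (intro prime_divisors_distinct_prime_product) auto
  have inj: "inj_on Prod (Pow ?X)"
    by (rule inj_on_inverseI[where g = "\<lambda>A. {P. poly_prime P \<and> P dvd A}"]) (rule div)
  have "(\<Sum>A | poly_monic A \<and> A dvd C. poly_mu A * int (poly_Omega A)) =
      (\<Sum>A\<in>Prod ` Pow ?X. poly_mu A * int (poly_Omega A))"
  proof (rule sum.mono_neutral_right[OF fin])
    show "Prod ` Pow ?X \<subseteq> {A. poly_monic A \<and> A dvd C}"
    proof safe
      fix S assume S: "S \<subseteq> ?X"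
      then show "poly_monic (\<Prod>S)" by (intro poly_monic_prod) (auto simp: poly_prime_def)
      show "\<Prod>S dvd C" using S finite_subset[OF S X] by (intro prod_poly_primes_dvd) auto
    qed
    have "poly_mu A = 0" if "poly_monic A" "A dvd C" "A \<notin> Prod ` Pow ?X" for A
    proof -
      have "\<not> distinct_prime_product k A" for k
      proof
        assume "distinct_prime_product k A"
        then obtain S where S: "finite S" "\<forall>P\<in>S. poly_prime P" "A = \<Prod>S"
          by (auto simp: distinct_prime_product_def)
        with that(2) have "S \<subseteq> ?X"
          using dvd_prodI[OF S(1), of _ "\<lambda>P. P"] by (auto intro: dvd_trans)
        with S that(3) show False by auto
      qed
      \<comment> \<open>\<open>poly_mu\<close> treats 1 in a separate branch; here 1 is excluded
        because it is the product over the empty subset.\<close>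
      moreover have "A \<noteq> 1" using that(3) by (auto intro!: image_eqI[of _ _ "{}"])
      ultimately show ?thesis by (simp add: poly_mu_def)
    qed
    then show "\<forall>A\<in>{A. poly_monic A \<and> A dvd C} - Prod ` Pow ?X. poly_mu A * int (poly_Omega A) = 0"
      by auto
  qed
  also have "\<dots> = (\<Sum>S\<in>Pow ?X. poly_mu (\<Prod>S) * int (poly_Omega (\<Prod>S)))"
    by (simp add: sum.reindex[OF inj])
  also have "\<dots> = (\<Sum>S\<in>Pow ?X. (-1) ^ card S * int (card (degree ` S)))"
  proof (rule sum.cong)
    fix S assume S: "S \<in> Pow ?X"
    then have "distinct_prime_product (card S) (\<Prod>S)"
      using finite_subset[OF _ X, of S] unfolding distinct_prime_product_def by blast
    moreover have "{degree P | P. poly_prime P \<and> P dvd \<Prod>S} = degree ` S"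
      using div[OF S] by blast
    ultimately show "poly_mu (\<Prod>S) * int (poly_Omega (\<Prod>S)) = (-1) ^ card S * int (card (degree ` S))"
      by (simp add: poly_mu_distinct_prime_product poly_Omega_def)
  qed simp
  also have "\<dots> = - (if card (degree ` ?X) = 1 then 1 else 0)"
    using X assms(2) by (rule sum_Pow_card_image)
  finally show ?thesis .
qed

section \<open>Prime factorization, and counting polynomials whose prime divisors share one
  degree\<close>

lemma monic_prime_factorization:
  fixes C :: "'a::field poly"
  assumes "poly_monic C"
  obtains M where "\<And>P. P \<in># M \<Longrightarrow> poly_prime P" "prod_mset M = C"
proof -
  have "\<exists>M. (\<forall>P\<in>#M. poly_prime P) \<and> prod_mset M = C"
    using assms
  proof (induction "degree C" arbitrary: C rule: less_induct)
    case less
    consider "C = 1" | "irreducible C" | A B where "C = A * B" "\<not> is_unit A" "\<not> is_unit B"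
      using less.prems monic_nonzero[OF less.prems] poly_monic_degree_0_iff[of C]
      by (auto simp: irreducible_def is_unit_iff_degree)
    then show ?case
    proof cases
      case 1
      then show ?thesis by (intro exI[of _ "{#}"]) simp
    next
      case 2
      with less.prems show ?thesis by (intro exI[of _ "{#C#}"]) (simp add: poly_prime_def)
    next
      case (3 A B)
      have nz: "A \<noteq> 0" "B \<noteq> 0" using 3 monic_nonzero[OF less.prems] by auto
      have lc: "lead_coeff A * lead_coeff B = 1"
        using 3(1) less.prems by (simp add: poly_monic_def lead_coeff_mult)
      \<comment> \<open>The factors need not be monic. Rescaling them preserves the product because
        their leading coefficients multiply to 1.\<close>
      let ?A = "smult (inverse (lead_coeff A)) A" and ?B = "smult (inverse (lead_coeff B)) B"
      have "poly_monic ?A" "poly_monic ?B" using nz by (simp_all add: poly_monic_def)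
      moreover have "degree ?A < degree C" "degree ?B < degree C"
        using 3 nz by (auto simp: degree_mult_eq is_unit_iff_degree)
      moreover have "?A * ?B = C"
        using lc 3(1) by (simp flip: inverse_mult_distrib add: mult.commute)
      ultimately obtain M N where "\<forall>P\<in>#M. poly_prime P" "prod_mset M = ?A"
          "\<forall>P\<in>#N. poly_prime P" "prod_mset N = ?B"
        using less.hyps by blast
      with \<open>?A * ?B = C\<close> show ?thesis by (intro exI[of _ "M + N"]) auto
    qed
  qed
  with that show ?thesis by blast
qed

lemma monic_prime_divisors_nonempty:
  assumes "poly_monic C" "0 < degree C"
  shows "{P. poly_prime P \<and> P dvd C} \<noteq> {}"
proof -
  obtain M where M: "\<And>P. P \<in># M \<Longrightarrow> poly_prime P" "prod_mset M = C"
    using monic_prime_factorization[OF assms(1)] by blast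
  with assms(2) have "M \<noteq> {#}" by auto
  then obtain P where "P \<in># M" by blast
  with M dvd_prod_mset[of P M] show ?thesis by auto
qed

lemma degree_prod_mset_eq:
  fixes M :: "'a::idom poly multiset"
  assumes "\<And>P. P \<in># M \<Longrightarrow> degree P = d" "0 \<notin># M"
  shows "degree (prod_mset M) = d * size M"
  using assms by (induction M) (auto simp: degree_mult_eq prod_mset_zero_iff)

text \<open>Such a \<open>C\<close> is the product of a multiset of \<open>m\<close> primes of one
  degree \<open>d\<close> with \<open>N = d * m\<close>. A union bound over the divisors
  \<open>m\<close> of \<open>N\<close> reduces the count to counting multisets.\<close>

lemma card_monic_one_prime_degree:
  assumes "0 < N"
  shows "real (card {C :: 'a::{field,finite} poly. poly_monic C \<and> degree C = N \<and>
      card (degree ` {P. poly_prime P \<and> P dvd C}) = 1}) \<le> 8 / real N * real CARD('a) ^ N"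
proof -
  let ?q = "real CARD('a)"
  let ?E = "{C :: 'a poly. poly_monic C \<and> degree C = N \<and> card (degree ` {P. poly_prime P \<and> P dvd C}) = 1}"
  let ?S = "\<lambda>d. {P :: 'a poly. poly_prime P \<and> degree P = d}"
  let ?I = "{m \<in> {1..N}. m dvd N}"
  have finS: "finite (?S d)" for d
    by (rule finite_subset[OF _ finite_poly_degree_le[of d]]) auto
  have "?E \<subseteq> (\<Union>m\<in>?I. prod_mset ` multisets_of_size (?S (N div m)) m)"
  proof
    fix C assume C: "C \<in> ?E"
    then obtain d where d: "degree ` {P. poly_prime P \<and> P dvd C} = {d}"
      by (auto simp: card_1_singleton_iff)
    obtain M where M: "\<And>P. P \<in># M \<Longrightarrow> poly_prime P" "prod_mset M = C"
      using monic_prime_factorization[of C] C by blast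
    have deg: "degree P = d" if "P \<in># M" for P
      using that M dvd_prod_mset[of P M] d by auto
    have "0 \<notin># M" using M(1)[of 0] by (auto simp: poly_prime_def)
    with degree_prod_mset_eq[of M d] deg M(2) C have "N = d * size M" by auto
    moreover from this have "1 \<le> size M" "1 \<le> d" using assms by (auto simp: Suc_le_eq)
    ultimately have "size M \<in> ?I" "N div size M = d" by auto
    moreover have "M \<in> multisets_of_size (?S d) (size M)"
      using M deg by (auto simp: multisets_of_size_def)
    ultimately show "C \<in> (\<Union>m\<in>?I. prod_mset ` multisets_of_size (?S (N div m)) m)"
      using M(2) by blast
  qed
  then have "card ?E \<le> card (\<Union>m\<in>?I. prod_mset ` multisets_of_size (?S (N div m)) m)"
    using finS by (intro card_mono finite_UN_I finite_imageI finite_multisets_of_size) auto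
  also have "\<dots> \<le> (\<Sum>m\<in>?I. card (prod_mset ` multisets_of_size (?S (N div m)) m))"
    by (rule card_UN_le) simp
  also have "\<dots> \<le> (\<Sum>m\<in>?I. card (multisets_of_size (?S (N div m)) m))"
    using finS by (intro sum_mono card_image_le finite_multisets_of_size)
  finally have "real (card ?E) \<le> (\<Sum>m\<in>?I. real (card (multisets_of_size (?S (N div m)) m)))"
    unfolding of_nat_sum[symmetric] of_nat_le_iff .
  also have "\<dots> \<le> (\<Sum>m\<in>?I. ?q ^ N / real N * (real m * real (m + 1) / 2 ^ m))"
  proof (rule sum_mono)
    fix m assume "m \<in> ?I"
    then obtain d where m: "1 \<le> m" and N: "N = d * m" by (auto elim: dvdE)
    have d: "0 < d" using assms N by (cases d) auto
    \<comment> \<open>This yields \<open>1 \<le> R\<close> in \<open>multiset_choose_le\<close> for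
      R = q^d / (2 d). The prime count is at most q^d / d, which is 2 R.\<close>
    have "2 * d \<le> 2 ^ d"
      using d by (induction d rule: nat_induct_non_zero) auto
    then have "real (2 * d) \<le> real (2 ^ d)" by (simp only: of_nat_le_iff)
    then have "2 * real d \<le> 2 ^ d" by simp
    also have "(2::real) ^ d \<le> ?q ^ d"
      using CARD_field_ge_2[where 'a = 'a] by (intro power_mono) auto
    finally have R: "1 \<le> ?q ^ d / (2 * real d)" using d by (simp add: field_simps)
    have "real (d * card (?S d)) \<le> ?q ^ d"
      using card_primes_degree[of d, where 'a = 'a]
      unfolding of_nat_power[symmetric] of_nat_le_iff .
    then have "real (card (?S d)) \<le> 2 * (?q ^ d / (2 * real d))"
      using d by (simp add: field_simps)
    from multiset_choose_le[OF this R, of m]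
    have "real (card (multisets_of_size (?S d) m)) \<le> real (m + 1) * (?q ^ d / (2 * real d)) ^ m"
      using finS by (simp add: card_multisets_of_size)
    also have "\<dots> = real (m + 1) * ?q ^ N / 2 ^ m / real d ^ m"
      by (simp add: N power_divide power_mult power_mult_distrib)
    \<comment> \<open>One factor \<open>d\<close> of the power is enough: 1 / d = m / N supplies the
      decay in \<open>N\<close>, while \<open>2 ^ m\<close> makes the sum over \<open>m\<close>
      bounded.\<close>
    also have "\<dots> \<le> real (m + 1) * ?q ^ N / 2 ^ m / real d ^ 1"
      using d m by (intro divide_left_mono power_increasing) auto
    also have "\<dots> = ?q ^ N / real N * (real m * real (m + 1) / 2 ^ m)"
      using m d by (simp add: N field_simps)
    finally show "real (card (multisets_of_size (?S (N div m)) m))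
        \<le> ?q ^ N / real N * (real m * real (m + 1) / 2 ^ m)"
      using m N by simp
  qed
  also have "\<dots> \<le> (\<Sum>m=1..N. ?q ^ N / real N * (real m * real (m + 1) / 2 ^ m))"
    by (rule sum_mono2) auto
  also have "\<dots> = ?q ^ N / real N * (\<Sum>m=1..N. real m * real (m + 1) / 2 ^ m)"
    by (rule sum_distrib_left[symmetric])
  also have "\<dots> \<le> ?q ^ N / real N * 8"
    by (intro mult_left_mono sum_m_Suc_m_power_half_le) simp
  finally show ?thesis by (simp add: mult.commute)
qed

section \<open>The partial sums and their limit\<close>

text \<open>Each weight 1 / q^(deg A) is the proportion of multiples of \<open>A\<close> among the
  monic polynomials of degree \<open>N\<close>. Swapping the sums leaves the divisor sums already
  evaluated.\<close>

lemma sum_mu_Omega_eq: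
  assumes "0 < N"
  shows "(\<Sum>A | poly_monic (A :: 'a::{field,finite} poly) \<and> 1 \<le> degree A \<and> degree A \<le> N.
      real_of_int (poly_mu A) * real (poly_Omega A) / real CARD('a) ^ degree A) =
    - real (card {C :: 'a poly. poly_monic C \<and> degree C = N \<and>
        card (degree ` {P. poly_prime P \<and> P dvd C}) = 1}) / real CARD('a) ^ N"
proof -
  let ?q = "real CARD('a)"
  let ?D = "{A :: 'a poly. poly_monic A \<and> degree A \<le> N}"
  let ?M = "{C :: 'a poly. poly_monic C \<and> degree C = N}"
  let ?g = "\<lambda>A :: 'a poly. poly_mu A * int (poly_Omega A)"
  let ?e = "\<lambda>C. card (degree ` {P. poly_prime P \<and> P dvd C}) = 1"
  have D: "finite ?D" by (rule finite_subset[OF _ finite_poly_degree_le[of N]]) auto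
  have M: "finite ?M" by (rule finite_monic_degree)
  have q: "0 < ?q" by simp
  \<comment> \<open>The term \<open>A = 1\<close> is zero, so it may be added; the divisor sums
    include it.\<close>
  have "{degree P | P :: 'a poly. poly_prime P \<and> P dvd 1} = {}"
    by (auto simp: poly_prime_def irreducible_def)
  then have "poly_Omega (1 :: 'a poly) = 0" by (simp only: poly_Omega_def card.empty)
  then have "(\<Sum>A | poly_monic (A :: 'a poly) \<and> 1 \<le> degree A \<and> degree A \<le> N.
      real_of_int (poly_mu A) * real (poly_Omega A) / ?q ^ degree A) =
      (\<Sum>A\<in>?D. real_of_int (?g A) / ?q ^ degree A)"
    using D by (intro sum.mono_neutral_cong_left)
      (auto simp: Suc_le_eq dest: poly_monic_degree_0_iff[THEN iffD1, OF conjI])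
  also have "\<dots> = (\<Sum>A\<in>?D. \<Sum>C\<in>?M. if A dvd C then real_of_int (?g A) else 0) / ?q ^ N"
  proof (subst sum_divide_distrib, rule sum.cong)
    fix A assume A: "A \<in> ?D"
    have "(\<Sum>C\<in>?M. if A dvd C then real_of_int (?g A) else 0) =
        real (card {C \<in> ?M. A dvd C}) * real_of_int (?g A)"
      using M by (simp add: sum.If_cases Int_def)
    also have "{C \<in> ?M. A dvd C} = {C. poly_monic C \<and> degree C = N \<and> A dvd C}" by auto
    also have "real (card \<dots>) = ?q ^ (N - degree A)" using A by (simp add: card_monic_multiples)
    also have "\<dots> = ?q ^ N / ?q ^ degree A" using A q by (intro power_diff) auto
    finally show "real_of_int (?g A) / ?q ^ degree A =
        (\<Sum>C\<in>?M. if A dvd C then real_of_int (?g A) else 0) / ?q ^ N"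
      using q by simp
  qed simp
  also have "(\<Sum>A\<in>?D. \<Sum>C\<in>?M. if A dvd C then real_of_int (?g A) else 0) =
      (\<Sum>C\<in>?M. \<Sum>A\<in>?D. if A dvd C then real_of_int (?g A) else 0)"
    by (rule sum.swap)
  also have "\<dots> = (\<Sum>C\<in>?M. - (if ?e C then 1 else 0))"
  proof (rule sum.cong)
    fix C assume C: "C \<in> ?M"
    \<comment> \<open>Every divisor of \<open>C\<close> has degree at most \<open>N\<close>, so
      \<open>?D\<close> contains all its monic divisors.\<close>
    then have "(\<Sum>A\<in>?D. if A dvd C then real_of_int (?g A) else 0) =
        real_of_int (\<Sum>A | poly_monic A \<and> A dvd C. ?g A)"
      unfolding of_int_sum using D monic_nonzero[of C]
      by (intro sum.mono_neutral_cong_right) (auto dest: dvd_imp_degree_le)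
    also have "(\<Sum>A | poly_monic A \<and> A dvd C. ?g A) = - (if ?e C then 1 else 0)"
      using C assms monic_prime_divisors_nonempty[of C]
      by (intro sum_monic_divisors_mu_Omega) auto
    finally show "(\<Sum>A\<in>?D. if A dvd C then real_of_int (?g A) else 0) = - (if ?e C then 1 else 0)"
      by simp
  qed simp
  also have "\<dots> = - real (card {C \<in> ?M. ?e C})"
    using M by (simp add: sum_negf sum.If_cases Int_def)
  finally show ?thesis by (simp add: conj_assoc)
qed

theorem theorem2p3:
  fixes q :: nat
  assumes "q = CARD('a::{field,finite})"
  shows "((\<lambda>x::real. \<Sum>A | poly_monic (A :: 'a poly) \<and> 1 \<le> degree A \<and> real (degree A) \<le> x.
            real_of_int (poly_mu A) * real (poly_Omega A) / real q ^ degree A) \<longlongrightarrow> 0) at_top"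
proof (rule tendsto_0_le[where K = 1])
  show "((\<lambda>x::real. 8 / (x - 1)) \<longlongrightarrow> 0) at_top"
    using filterlim_tendsto_add_at_top[OF tendsto_const[of "-1 :: real"] filterlim_ident]
    by (intro tendsto_divide_0[OF tendsto_const] filterlim_at_top_imp_at_infinity) simp
  show "\<forall>\<^sub>F x in at_top. norm (\<Sum>A | poly_monic (A :: 'a poly) \<and> 1 \<le> degree A \<and> real (degree A) \<le> x.
      real_of_int (poly_mu A) * real (poly_Omega A) / real q ^ degree A) \<le> norm (8 / (x - 1)) * 1"
    using eventually_ge_at_top[of "2::real"]
  proof eventually_elim
    case (elim x)
    \<comment> \<open>As \<open>x \<ge> 2\<close>, both \<open>N\<close> and \<open>x - 1\<close>
      are positive, and \<open>x - 1 \<le> N\<close> turns the bound 8 / N into one in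
      \<open>x\<close>.\<close>
    define N where "N = nat \<lfloor>x\<rfloor>"
    have N: "0 < N" "x - 1 \<le> real N" "real k \<le> x \<longleftrightarrow> k \<le> N" for k
      using elim unfolding N_def by linarith+
    let ?E = "{C :: 'a poly. poly_monic C \<and> degree C = N \<and>
        card (degree ` {P. poly_prime P \<and> P dvd C}) = 1}"
    have "norm (\<Sum>A | poly_monic (A :: 'a poly) \<and> 1 \<le> degree A \<and> real (degree A) \<le> x.
        real_of_int (poly_mu A) * real (poly_Omega A) / real q ^ degree A) =
        real (card ?E) / real q ^ N"
      using sum_mu_Omega_eq[OF N(1), where 'a = 'a] by (simp add: assms N(3))
    also have "\<dots> \<le> 8 / real N"
      using card_monic_one_prime_degree[OF N(1), where 'a = 'a] by (simp add: assms field_simps)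
    also have "\<dots> \<le> 8 / (x - 1)" using N elim by (intro divide_left_mono) auto
    also have "\<dots> = norm (8 / (x - 1)) * 1" using elim by simp
    finally show ?case .
  qed
qed

end
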